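(* Let $M'^{4}_{h}(o')$ be a $4$-dimensional model with pole $o'$ and warping function $h$, and assume that $h$ satisfies $$h^2\,h'''+h'\,(2+h\,h'')-2\,(h')^3=0 .$$ Then $M'^{4}_{h}(o')$ has constant sectional curvature.
   Context: An $m$-dimensional Riemannian manifold with a pole $o$ is a model if every linear isometry of $T_oM$ is the differential at $o$ of an isometry of $M$. In geodesic polar coordinates centered at the pole, a model is written $$M^m_f(o)=\left(\mathbb{S}^{m-1}\times[0,+\infty),\ f^2(r)\,g_{\mathbb{S}^{m-1}}+dr^2\right),$$ where $g_{\mathbb{S}^{m-1}}$ is the metric of the Euclidean unit sphere, $r$ is the distance from the pole, and $f$ (the warping function) is smooth with $f(0)=0$, $f'(0)=1$, $f(r)>0$ for $r>0$, and $f^{(2k)}(0)=0$ for all $k\ge 1$. With a slight abuse of terminology, one also allows $f$ to be defined on a finite interval $[0,b]$, with, in addition, $f(b)=0$, $f'(b)=-1$ and $f^{(2k)}(b)=0$ for all $k\ge1$ (for example $f(r)=\sin r$ on $[0,\pi]$, giving the round sphere). *)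

theory Defs
  imports "HOL-Analysis.Analysis" "HOL-Library.Extended_Real"
begin

section \<open>Curvature of a Riemannian metric in coordinates\<close>

text \<open>A Riemannian metric on a coordinate patch in \<open>real^'n\<close> is the field of its Gram matrices
  \<open>g x $ i $ j\<close> in the coordinate basis.\<close>

type_synonym 'n metric = "real^'n \<Rightarrow> real^'n^'n"

definition metric_inner :: "'n::finite metric \<Rightarrow> real^'n \<Rightarrow> real^'n \<Rightarrow> real^'n \<Rightarrow> real" where
  "metric_inner g x u v = (\<Sum>i\<in>UNIV. \<Sum>j\<in>UNIV. g x $ i $ j * u $ i * v $ j)"

definition partial_deriv :: "'n::finite \<Rightarrow> (real^'n \<Rightarrow> real) \<Rightarrow> real^'n \<Rightarrow> real" where
  "partial_deriv i \<phi> x = deriv (\<lambda>t. \<phi> (x + t *\<^sub>R axis i 1)) 0"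

text \<open>\<open>christoffel g k i j\<close> is the \<open>k\<close>-th component of the Levi-Civita derivative of the
  \<open>j\<close>-th coordinate field along the \<open>i\<close>-th one.\<close>

definition christoffel :: "'n::finite metric \<Rightarrow> 'n \<Rightarrow> 'n \<Rightarrow> 'n \<Rightarrow> real^'n \<Rightarrow> real" where
  "christoffel g k i j x =
     (\<Sum>l\<in>UNIV. matrix_inv (g x) $ k $ l *
        (partial_deriv i (\<lambda>y. g y $ j $ l) x + partial_deriv j (\<lambda>y. g y $ i $ l) x
         - partial_deriv l (\<lambda>y. g y $ i $ j) x)) / 2"

text \<open>\<open>riemann_coeff g l i j k\<close> is the \<open>l\<close>-th component of \<open>R(\<partial>\<^sub>i, \<partial>\<^sub>j) \<partial>\<^sub>k\<close>, with the
  convention \<open>R(X,Y)Z = \<nabla>\<^sub>X\<nabla>\<^sub>Y Z - \<nabla>\<^sub>Y\<nabla>\<^sub>X Z - \<nabla>\<^sub>[\<^sub>X\<^sub>,\<^sub>Y\<^sub>] Z\<close>.\<close>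

definition riemann_coeff ::
    "'n::finite metric \<Rightarrow> 'n \<Rightarrow> 'n \<Rightarrow> 'n \<Rightarrow> 'n \<Rightarrow> real^'n \<Rightarrow> real" where
  "riemann_coeff g l i j k x =
     partial_deriv i (christoffel g l j k) x - partial_deriv j (christoffel g l i k) x
     + (\<Sum>p\<in>UNIV. christoffel g l i p x * christoffel g p j k x
                  - christoffel g l j p x * christoffel g p i k x)"

definition riemann ::
    "'n::finite metric \<Rightarrow> real^'n \<Rightarrow> real^'n \<Rightarrow> real^'n \<Rightarrow> real^'n \<Rightarrow> real^'n" where
  "riemann g x u v w =
     (\<chi> l. \<Sum>i\<in>UNIV. \<Sum>j\<in>UNIV. \<Sum>k\<in>UNIV. riemann_coeff g l i j k x * u $ i * v $ j * w $ k)"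

text \<open>Sectional curvature of the plane spanned by linearly independent \<open>u\<close> and \<open>v\<close>.\<close>

definition sectional_curvature ::
    "'n::finite metric \<Rightarrow> real^'n \<Rightarrow> real^'n \<Rightarrow> real^'n \<Rightarrow> real" where
  "sectional_curvature g x u v =
     metric_inner g x (riemann g x u v v) u /
     (metric_inner g x u u * metric_inner g x v v - (metric_inner g x u v)\<^sup>2)"

text \<open>A Riemannian manifold is represented by an atlas of isometric coordinate patches, i.e. of pairs
  of a chart image and the metric on it.\<close>

definition constant_sectional_curvature :: "((real^'n::finite) set \<times> 'n metric) set \<Rightarrow> bool" where
  "constant_sectional_curvature \<A> \<longleftrightarrow>
     (\<exists>\<kappa>. \<forall>(U, g)\<in>\<A>. \<forall>x\<in>U. \<forall>u v. u \<noteq> v \<and> independent {u, v} \<longrightarrow>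
        sectional_curvature g x u v = \<kappa>)"

section \<open>Warping functions\<close>

text \<open>Iterated derivative relative to \<open>S\<close>, hence one-sided at the endpoints of an interval.\<close>

definition nth_deriv_on :: "real set \<Rightarrow> nat \<Rightarrow> (real \<Rightarrow> real) \<Rightarrow> real \<Rightarrow> real" where
  "nth_deriv_on S k f = ((\<lambda>\<phi> r. vector_derivative \<phi> (at r within S)) ^^ k) f"

definition smooth_on_real :: "real set \<Rightarrow> (real \<Rightarrow> real) \<Rightarrow> bool" where
  "smooth_on_real S f \<longleftrightarrow> (\<forall>k. nth_deriv_on S k f differentiable_on S)"

text \<open>The domain is \<open>[0, +\<infinity>)\<close> for \<open>b = \<infinity>\<close> and the compact interval \<open>[0, b]\<close> for finite \<open>b\<close>.\<close>

definition warping_domain :: "ereal \<Rightarrow> real set" where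
  "warping_domain b = {r. 0 \<le> r \<and> ereal r \<le> b}"

definition warping_function :: "ereal \<Rightarrow> (real \<Rightarrow> real) \<Rightarrow> bool" where
  "warping_function b f \<longleftrightarrow>
     0 < b \<and> smooth_on_real (warping_domain b) f \<and>
     f 0 = 0 \<and> nth_deriv_on (warping_domain b) 1 f 0 = 1 \<and>
     (\<forall>r. 0 < r \<and> ereal r < b \<longrightarrow> 0 < f r) \<and>
     (\<forall>k\<ge>1. nth_deriv_on (warping_domain b) (2 * k) f 0 = 0) \<and>
     (\<forall>\<beta>. b = ereal \<beta> \<longrightarrow>
        f \<beta> = 0 \<and> nth_deriv_on (warping_domain b) 1 f \<beta> = -1 \<and>
        (\<forall>k\<ge>1. nth_deriv_on (warping_domain b) (2 * k) f \<beta> = 0))"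

section \<open>Model manifolds\<close>

text \<open>Geodesic normal coordinates at the pole: a point with polar coordinates \<open>(\<theta>, r)\<close> is
  \<open>x = r *\<^sub>R \<theta>\<close>, so \<open>r = norm x\<close> and \<open>\<theta> = sgn x\<close>, and for \<open>x \<noteq> 0\<close> the form below is the pullback of
  the polar expression \<open>f\<^sup>2(r) g\<^sub>S + dr\<^sup>2\<close>, the sphere metric being induced by the inner product. At the
  pole itself, where polar coordinates degenerate, the metric is its continuous extension, which by
  \<open>f(0) = 0\<close>, \<open>f'(0) = 1\<close> is the Euclidean inner product.\<close>

definition model_form :: "(real \<Rightarrow> real) \<Rightarrow> real^'n::finite \<Rightarrow> real^'n \<Rightarrow> real^'n \<Rightarrow> real" where
  "model_form f x u v =
     (if x = 0 then u \<bullet> v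
      else (f (norm x))\<^sup>2 * (frechet_derivative sgn (at x) u \<bullet> frechet_derivative sgn (at x) v)
           + frechet_derivative norm (at x) u * frechet_derivative norm (at x) v)"

definition model_metric :: "(real \<Rightarrow> real) \<Rightarrow> 'n::finite metric" where
  "model_metric f x = (\<chi> i j. model_form f x (axis i 1) (axis j 1))"

text \<open>For \<open>b = \<infinity>\<close> normal coordinates at the pole cover the model. For finite \<open>b\<close> they miss only the
  antipodal point \<open>r = b\<close>, which is covered by normal coordinates centred there: its distance
  function is \<open>b - r\<close>, so the metric has the same form with \<open>f (b - s)\<close> in place of \<open>f s\<close>.
  Both patches describe one metric, see \<open>model_form_transition\<close>.\<close>

definition model_atlas :: "ereal \<Rightarrow> (real \<Rightarrow> real) \<Rightarrow> ((real^'n::finite) set \<times> 'n metric) set" where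
  "model_atlas b f =
     {({x. ereal (norm x) < b}, model_metric f)} \<union>
     {({x. norm x < \<beta>}, model_metric (\<lambda>s. f (\<beta> - s))) |\<beta>. b = ereal \<beta>}"

lemma model_form_transition:
  fixes x u v :: "real^'n::finite" and \<beta> :: real
  defines "\<Phi> \<equiv> \<lambda>y::real^'n. (\<beta> - norm y) *\<^sub>R sgn y"
  assumes x: "x \<noteq> 0" "norm x < \<beta>"
  shows "model_form (\<lambda>s. f (\<beta> - s)) (\<Phi> x)
           (frechet_derivative \<Phi> (at x) u) (frechet_derivative \<Phi> (at x) v) = model_form f x u v"
proof -
  have dn: "norm differentiable at z" if "z \<noteq> 0" for z :: "real^'n"
    using that by (simp add: differentiable_norm_at)
  have ds: "sgn differentiable at z" if "z \<noteq> 0" for z :: "real^'n"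
    unfolding sgn_div_norm[abs_def] using dn[OF that] that
    by (intro differentiable_scaleR differentiable_inverse) auto
  have d\<Phi>: "\<Phi> differentiable at x"
    unfolding \<Phi>_def using dn[OF x(1)] ds[OF x(1)]
    by (intro differentiable_scaleR differentiable_diff differentiable_const)
  have ss: "sgn (sgn z) = sgn z" for z :: "real^'n"
    by (cases "z = 0") (simp_all add: sgn_div_norm[of "sgn z"] norm_sgn)
  have norm_\<Phi>: "norm (\<Phi> y) = \<beta> - norm y" and sgn_\<Phi>: "sgn (\<Phi> y) = sgn y"
    if "y \<noteq> 0" "norm y < \<beta>" for y
    using that by (simp_all add: \<Phi>_def norm_sgn sgn_scaleR ss)
  have \<Phi>0: "\<Phi> x \<noteq> 0"
    using norm_\<Phi>[OF x] x by auto
  define V where "V = {y::real^'n. y \<noteq> 0 \<and> norm y < \<beta>}"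
  have V: "open V" "x \<in> V"
    unfolding V_def using x by (auto intro!: open_Collect_conj open_Collect_neq open_Collect_less continuous_intros)
  have D\<Phi>: "(\<Phi> has_derivative frechet_derivative \<Phi> (at x)) (at x)"
    using d\<Phi> frechet_derivative_works by blast
  have "((norm \<circ> \<Phi>) has_derivative frechet_derivative norm (at (\<Phi> x)) \<circ> frechet_derivative \<Phi> (at x)) (at x)"
    using diff_chain_at D\<Phi> dn[OF \<Phi>0] frechet_derivative_works by blast
  then have 1: "((\<lambda>y. \<beta> - norm y) has_derivative frechet_derivative norm (at (\<Phi> x)) \<circ> frechet_derivative \<Phi> (at x)) (at x)"
    by (rule has_derivative_transform_within_open[OF _ V]) (auto simp: V_def norm_\<Phi>)
  have "((\<lambda>y. \<beta> - norm y) has_derivative (\<lambda>w. - frechet_derivative norm (at x) w)) (at x)"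
    using dn[OF x(1)] by (auto intro!: derivative_eq_intros simp: frechet_derivative_works)
  from has_derivative_unique[OF 1 this]
  have n: "frechet_derivative norm (at (\<Phi> x)) (frechet_derivative \<Phi> (at x) w) = - frechet_derivative norm (at x) w" for w
    by (metis comp_apply)
  have "((sgn \<circ> \<Phi>) has_derivative frechet_derivative sgn (at (\<Phi> x)) \<circ> frechet_derivative \<Phi> (at x)) (at x)"
    using diff_chain_at D\<Phi> ds[OF \<Phi>0] frechet_derivative_works by blast
  then have 2: "(sgn has_derivative frechet_derivative sgn (at (\<Phi> x)) \<circ> frechet_derivative \<Phi> (at x)) (at x)"
    by (rule has_derivative_transform_within_open[OF _ V]) (auto simp: V_def sgn_\<Phi>)
  have "(sgn has_derivative frechet_derivative sgn (at x)) (at x)"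
    using ds[OF x(1)] frechet_derivative_works by blast
  from has_derivative_unique[OF 2 this]
  have s: "frechet_derivative sgn (at (\<Phi> x)) (frechet_derivative \<Phi> (at x) w) = frechet_derivative sgn (at x) w" for w
    by (metis comp_apply)
  show ?thesis
    using \<Phi>0 x by (simp add: model_form_def n s norm_\<Phi>)
qed

end

theory Submission
  imports Defs
begin

text \<open>The proof has an analytic and a geometric half. A model has only two principal sectional curvatures, the
radial one \<open>K\<^sub>r = - h'' / h\<close> and the tangential one \<open>K\<^sub>t = (1 - h'\<^sup>2) / h\<^sup>2\<close>. In dimension four the scalar
curvature is \<open>6 (K\<^sub>r + K\<^sub>t)\<close>, and the equation for \<open>h\<close> says that it is constant. Every warping function satisfies
\<open>K\<^sub>t' = 2 (h' / h) (K\<^sub>r - K\<^sub>t)\<close>, so \<open>(h\<^sup>4 (K\<^sub>r - K\<^sub>t))' = 0\<close>; as this quantity vanishes at the pole,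
\<open>K\<^sub>r = K\<^sub>t\<close>, and both equal a constant \<open>\<kappa>\<close>. This is \<open>warping_ode_linear\<close>, which turns the nonlinear equation
into \<open>h'' = - \<kappa> h\<close>. By \<open>jacobi_ode_solution\<close> then \<open>h r = r * S (r\<^sup>2)\<close>, where \<open>S t\<close> is the power series of
\<open>sin (sqrt (\<kappa> t)) / sqrt (\<kappa> t)\<close>.

It remains to compute the curvature of the metric in normal coordinates, on all planes and at the pole as well,
where polar coordinates are of no use. Because \<open>S\<close> is evaluated at \<open>t = \<bar>x\<bar>\<^sup>2\<close>, the metric is \<open>\<phi> I + \<psi> x x\<^sup>T\<close>
with \<open>\<phi> = S\<^sup>2\<close> and \<open>\<psi> = (1 - S\<^sup>2) / t\<close>, both power series in \<open>t\<close>. For such metrics \<open>christoffel_radial\<close> and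
\<open>riemann_coeff_radial\<close> give closed formulas valid at every point, and \<open>space_form_identities\<close> shows that
the curvature tensor is \<open>R(u, v) w = \<kappa> (g(v, w) u - g(u, w) v)\<close>. For a compact model the patch around the
antipodal point is treated in the same way, with the same \<open>\<kappa>\<close>.\<close>

section \<open>Rotationally symmetric metrics\<close>

text \<open>The Kronecker delta is kept as an opaque real number: the curvature identities below are polynomial
  identities in the deltas and the coordinates, and need no case distinction on the indices.\<close>

definition kron :: "'a \<Rightarrow> 'a \<Rightarrow> real" where "kron i j = of_bool (i = j)"

lemma kron_commute: "kron i j = kron j i"
  by (auto simp: kron_def)

lemma sum_kron_left [simp]:
  fixes f :: "'n::finite \<Rightarrow> real"
  shows "(\<Sum>p\<in>UNIV. kron i p * f p) = f i" "(\<Sum>p\<in>UNIV. kron p i * f p) = f i"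
  by (simp_all add: kron_def)

lemma sum_kron_right [simp]:
  fixes f :: "'n::finite \<Rightarrow> real"
  shows "(\<Sum>p\<in>UNIV. f p * kron i p) = f i" "(\<Sum>p\<in>UNIV. f p * kron p i) = f i"
  by (simp_all add: kron_def)

lemma coordinate_has_derivative:
  fixes x :: "real^'n::finite"
  shows "((\<lambda>s. (x + s *\<^sub>R axis i 1) $ j) has_real_derivative kron i j) (at 0)"
  by (auto intro!: derivative_eq_intros simp: kron_def axis_def)

lemma radial_has_derivative:
  fixes x :: "real^'n::finite"
  assumes "(F has_real_derivative F') (at (x \<bullet> x))"
  shows "((\<lambda>s. F ((x + s *\<^sub>R axis i 1) \<bullet> (x + s *\<^sub>R axis i 1))) has_real_derivative
           F' * (2 * x $ i)) (at 0)"
proof -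
  have "((\<lambda>s. (x + s *\<^sub>R axis i 1) \<bullet> (x + s *\<^sub>R axis i 1)) has_real_derivative 2 * x $ i) (at 0)"
    by (auto intro!: derivative_eq_intros
        simp: inner_add_left inner_add_right inner_axis inner_axis')
  from DERIV_chain2[OF _ this, of F F'] assms show ?thesis by simp
qed

text \<open>The Christoffel symbols are known in closed form only on the patch, which suffices to
  differentiate them because the patch is open.\<close>

lemma partial_deriv_eqI:
  fixes x :: "real^'n::finite"
  assumes "open U" "x \<in> U" "\<And>y. y \<in> U \<Longrightarrow> F y = G y"
    and "((\<lambda>s. G (x + s *\<^sub>R axis i 1)) has_real_derivative D) (at 0)"
  shows "partial_deriv i F x = D"
proof -
  have "open {s::real. x + s *\<^sub>R axis i 1 \<in> U}"
    using open_vimage[OF assms(1), of "\<lambda>s::real. x + s *\<^sub>R axis i 1"]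
    by (simp add: vimage_def continuous_intros)
  with assms(4) have "((\<lambda>s. F (x + s *\<^sub>R axis i 1)) has_real_derivative D) (at 0)"
    by (rule has_field_derivative_transform_within_open) (use assms(2,3) in auto)
  then show ?thesis
    unfolding partial_deriv_def by (rule DERIV_imp_deriv)
qed

text \<open>A rotationally symmetric metric is \<open>\<phi> I + \<psi> x x\<^sup>T\<close> with \<open>\<phi>\<close>, \<open>\<psi>\<close> evaluated at \<open>\<bar>x\<bar>\<^sup>2\<close>. Radial lines have
  unit speed exactly when \<open>\<phi> + \<bar>x\<bar>\<^sup>2 \<psi> = 1\<close>; then \<open>x\<close> is an eigenvector of the Gram matrix with eigenvalue 1
  and the inverse is simply \<open>(I - \<psi> x x\<^sup>T) / \<phi>\<close>. By symmetry the Christoffel symbols can only be built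
  from the three tensors that appear here.\<close>

lemma christoffel_radial:
  fixes g :: "'n::finite metric"
  assumes U: "open U" "x \<in> U"
    and g: "\<And>y i j. y \<in> U \<Longrightarrow>
          g y $ i $ j = \<phi> (y \<bullet> y) * kron i j + \<psi> (y \<bullet> y) * (y $ i * y $ j)"
    and \<phi>: "(\<phi> has_real_derivative \<phi>') (at (x \<bullet> x))" "\<phi> (x \<bullet> x) \<noteq> 0"
    and \<psi>: "(\<psi> has_real_derivative \<psi>') (at (x \<bullet> x))"
    and radial_unit: "\<phi> (x \<bullet> x) + (x \<bullet> x) * \<psi> (x \<bullet> x) = 1"
  shows "christoffel g k i j x =
           \<phi>' / \<phi> (x \<bullet> x) * (x $ i * kron j k + x $ j * kron i k)
           + (\<psi> (x \<bullet> x) - \<phi>') * (kron i j * x $ k)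
           + (\<psi>' - 2 * \<phi>' * \<psi> (x \<bullet> x) / \<phi> (x \<bullet> x)) * (x $ i * x $ j * x $ k)"
proof -
  define t where "t = x \<bullet> x"
  define p q where "p = \<phi> t" and "q = \<psi> t"
  have p0: "p \<noteq> 0" and unit: "p + t * q = 1"
    using \<phi>(2) radial_unit by (simp_all add: p_def q_def t_def)
  have xx: "(\<Sum>l\<in>UNIV. x $ l * x $ l) = t"
    by (simp add: t_def inner_vec_def)
  have dg: "partial_deriv m (\<lambda>y. g y $ a $ c) x =
      2 * \<phi>' * x $ m * kron a c + 2 * \<psi>' * x $ m * x $ a * x $ c
      + q * (kron m a * x $ c + kron m c * x $ a)" for m a c
    apply (rule partial_deriv_eqI[OF U g], assumption)
    apply (rule derivative_eq_intros radial_has_derivative[OF \<phi>(1)] radial_has_derivative[OF \<psi>]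
           coordinate_has_derivative refl)+
    apply (simp add: q_def t_def algebra_simps)
    done
  define G where "G = (\<chi> a c. (kron a c - q * (x $ a * x $ c)) / p)"
  have gx: "g x $ a $ c = p * kron a c + q * (x $ a * x $ c)" for a c
    by (simp add: g[OF U(2)] p_def q_def t_def)
  have prod: "(\<Sum>l\<in>UNIV. (p * kron a l + q * (x $ a * x $ l)) * ((kron l c - q * (x $ l * x $ c)) / p))
      = kron a c" for a c
  proof -
    have "(\<Sum>l\<in>UNIV. (p * kron a l + q * (x $ a * x $ l)) * ((kron l c - q * (x $ l * x $ c)) / p))
       = (\<Sum>l\<in>UNIV. kron a l * (kron l c - q * (x $ l * x $ c)))
         + q / p * x $ a * (\<Sum>l\<in>UNIV. x $ l * kron l c)
         - q * q / p * x $ a * x $ c * (\<Sum>l\<in>UNIV. x $ l * x $ l)"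
      unfolding sum_distrib_left sum.distrib[symmetric] sum_subtractf[symmetric]
      by (rule sum.cong[OF refl]) (use p0 in \<open>simp add: field_simps\<close>)
    also have "\<dots> = kron a c + q * x $ a * x $ c * (1 - p - t * q) / p"
      unfolding sum_kron_left sum_kron_right xx using p0 by (simp add: field_simps)
    finally show ?thesis using unit by simp
  qed
  have "(g x ** G) $ a $ c = mat 1 $ a $ c" for a c
  proof -
    have "(g x ** G) $ a $ c =
        (\<Sum>l\<in>UNIV. (p * kron a l + q * (x $ a * x $ l)) * ((kron l c - q * (x $ l * x $ c)) / p))"
      by (simp add: matrix_matrix_mult_def G_def gx)
    also have "\<dots> = kron a c" by (rule prod)
    finally show ?thesis by (simp add: kron_def mat_def)
  qed
  then have gG: "g x ** G = mat 1"
    by (simp add: vec_eq_iff)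
  then have Gg: "G ** g x = mat 1"
    using matrix_left_right_inverse by blast
  then have "g x ** matrix_inv (g x) = mat 1"
    unfolding matrix_inv_def using gG by (metis (mono_tags, lifting) someI)
  with Gg have "matrix_inv (g x) = G"
    by (metis matrix_mul_assoc matrix_mul_lid matrix_mul_rid)
  then have inv: "matrix_inv (g x) $ k $ l = (kron k l - q * (x $ k * x $ l)) / p" for l
    by (simp add: G_def)
  have "christoffel g k i j x = (\<Sum>l\<in>UNIV. (kron k l - q * (x $ k * x $ l)) / p *
      (\<phi>' * (x $ i * kron j l + x $ j * kron i l - x $ l * kron i j)
       + \<psi>' * x $ i * x $ j * x $ l + q * kron i j * x $ l))"
    unfolding christoffel_def dg inv sum_divide_distrib
    by (rule sum.cong[OF refl]) (simp add: algebra_simps kron_commute add_divide_distrib diff_divide_distrib)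
  also have "\<dots> = (\<Sum>l\<in>UNIV. kron k l * 
      (\<phi>' * (x $ i * kron j l + x $ j * kron i l - x $ l * kron i j)
       + \<psi>' * x $ i * x $ j * x $ l + q * kron i j * x $ l)) / p
     - q * x $ k / p * (\<phi>' * x $ i * (\<Sum>l\<in>UNIV. x $ l * kron j l) + \<phi>' * x $ j * (\<Sum>l\<in>UNIV. x $ l * kron i l)
         + (\<psi>' * x $ i * x $ j + (q - \<phi>') * kron i j) * (\<Sum>l\<in>UNIV. x $ l * x $ l))"
    unfolding sum_distrib_left sum_divide_distrib sum.distrib[symmetric] sum_subtractf[symmetric]
    by (rule sum.cong[OF refl]) (simp add: algebra_simps add_divide_distrib diff_divide_distrib)
  also have "\<dots> = (\<phi>' * (x $ i * kron j k + x $ j * kron i k)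
       + (\<psi>' * x $ i * x $ j + (q - \<phi>') * kron i j) * x $ k * (1 - t * q)
       - 2 * q * \<phi>' * x $ i * x $ j * x $ k) / p"
    unfolding sum_kron_left sum_kron_right xx
    by (simp add: kron_commute algebra_simps add_divide_distrib diff_divide_distrib)
  also have "1 - t * q = p" using unit by simp
  also have "(\<phi>' * (x $ i * kron j k + x $ j * kron i k)
       + (\<psi>' * x $ i * x $ j + (q - \<phi>') * kron i j) * x $ k * p
       - 2 * q * \<phi>' * x $ i * x $ j * x $ k) / p =
      \<phi>' / p * (x $ i * kron j k + x $ j * kron i k) + (q - \<phi>') * (kron i j * x $ k)
       + (\<psi>' - 2 * \<phi>' * q / p) * (x $ i * x $ j * x $ k)"
    using p0 by (simp add: add_divide_distrib diff_divide_distrib algebra_simps)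
  finally show ?thesis
    by (simp only: p_def q_def t_def)
qed

text \<open>The terms with four factors \<open>x\<close> cancel by antisymmetry in \<open>i\<close>, \<open>j\<close>, and so does the derivative of
  \<open>C\<close>. Three scalar functions are left; the metric is a space form of curvature \<open>\<kappa>\<close> when they equal
  \<open>\<kappa> \<phi>\<close>, \<open>\<kappa> \<psi>\<close> and \<open>0\<close>.\<close>

lemma riemann_coeff_radial:
  fixes g :: "'n::finite metric"
  assumes U: "open U" "x \<in> U"
    and \<Gamma>: "\<And>y i j k. y \<in> U \<Longrightarrow> christoffel g k i j y =
          A (y \<bullet> y) * (y $ i * kron j k + y $ j * kron i k) + B (y \<bullet> y) * (kron i j * y $ k)
          + C (y \<bullet> y) * (y $ i * y $ j * y $ k)"
    and A: "(A has_real_derivative A') (at (x \<bullet> x))"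
    and B: "(B has_real_derivative B') (at (x \<bullet> x))"
    and C: "(C has_real_derivative C') (at (x \<bullet> x))"
  defines "t \<equiv> x \<bullet> x"
  shows "riemann_coeff g l i j k x =
           (B t - A t + t * A t * B t) * (kron j k * kron i l - kron i k * kron j l)
           + ((A t)\<^sup>2 + C t + t * A t * C t - 2 * A') * x $ k * (x $ j * kron i l - x $ i * kron j l)
           + ((B t)\<^sup>2 - C t + t * B t * C t + 2 * B') * x $ l * (x $ i * kron j k - x $ j * kron i k)"
proof -
  have xx: "(\<Sum>l\<in>UNIV. x $ l * x $ l) = t"
    by (simp add: t_def inner_vec_def)
  have d\<Gamma>: "partial_deriv m (christoffel g k i j) x =
        2 * A' * x $ m * (x $ i * kron j k + x $ j * kron i k)
        + A t * (kron m i * kron j k + kron m j * kron i k)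
        + 2 * B' * x $ m * kron i j * x $ k + B t * kron i j * kron m k
        + 2 * C' * x $ m * x $ i * x $ j * x $ k
        + C t * (kron m i * x $ j * x $ k + kron m j * x $ i * x $ k + kron m k * x $ i * x $ j)"
    for m k i j
    apply (rule partial_deriv_eqI[OF U \<Gamma>], assumption)
    apply (rule derivative_eq_intros radial_has_derivative[OF A] radial_has_derivative[OF B]
           radial_has_derivative[OF C] coordinate_has_derivative refl)+
    apply (simp add: t_def algebra_simps)
    done
  note \<Gamma>x = \<Gamma>[OF U(2), folded t_def]
  \<comment> \<open>Contracting the first factor before inserting the second keeps the sums over \<open>p\<close> few: only \<open>x\<close> is
    ever contracted with a Christoffel symbol, which is the next fact.\<close>
  have contract: "(\<Sum>p\<in>UNIV. christoffel g l i p x * F p) =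
      A t * x $ i * F l + (A t * kron i l + C t * x $ i * x $ l) * (\<Sum>p\<in>UNIV. x $ p * F p)
      + B t * x $ l * F i" for l i F
  proof -
    have "(\<Sum>p\<in>UNIV. christoffel g l i p x * F p) =
       A t * x $ i * (\<Sum>p\<in>UNIV. kron p l * F p)
       + (A t * kron i l + C t * x $ i * x $ l) * (\<Sum>p\<in>UNIV. x $ p * F p)
       + B t * x $ l * (\<Sum>p\<in>UNIV. kron i p * F p)"
      unfolding sum_distrib_left sum.distrib[symmetric] \<Gamma>x
      by (rule sum.cong[OF refl]) (simp add: algebra_simps)
    then show ?thesis by simp
  qed
  have radial: "(\<Sum>p\<in>UNIV. x $ p * christoffel g p j k x) =
      (2 * A t + t * C t) * x $ j * x $ k + t * B t * kron j k" for j k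
  proof -
    have "(\<Sum>p\<in>UNIV. x $ p * christoffel g p j k x) =
      A t * x $ j * (\<Sum>p\<in>UNIV. kron k p * x $ p) + A t * x $ k * (\<Sum>p\<in>UNIV. kron j p * x $ p)
      + (B t * kron j k + C t * x $ j * x $ k) * (\<Sum>p\<in>UNIV. x $ p * x $ p)"
      unfolding sum_distrib_left sum.distrib[symmetric] \<Gamma>x
      by (rule sum.cong[OF refl]) (simp add: algebra_simps)
    then show ?thesis by (simp add: xx algebra_simps)
  qed
  have sym: "kron j i = kron i j" "kron k j = kron j k" "kron k i = kron i k" by (simp_all add: kron_commute)
  show ?thesis
    unfolding riemann_coeff_def sum_subtractf d\<Gamma>
    unfolding contract radial
    unfolding \<Gamma>x
    by (simp add: sym algebra_simps power2_eq_square)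
qed

lemma riemann_of_space_form:
  assumes "\<And>l i j k. riemann_coeff g l i j k x =
      \<kappa> * (g x $ j $ k * kron i l - g x $ i $ k * kron j l)"
  shows "riemann g x u v w = \<kappa> *\<^sub>R (metric_inner g x v w *\<^sub>R u - metric_inner g x u w *\<^sub>R v)"
proof (rule vec_eq_iff[THEN iffD2], rule allI)
  fix l
  have "riemann g x u v w $ l =
     \<kappa> * ((\<Sum>j\<in>UNIV. \<Sum>k\<in>UNIV. g x $ j $ k * v $ j * w $ k) * (\<Sum>i\<in>UNIV. kron i l * u $ i)
        - (\<Sum>i\<in>UNIV. \<Sum>k\<in>UNIV. g x $ i $ k * u $ i * w $ k) * (\<Sum>j\<in>UNIV. kron j l * v $ j))"
  proof -
    have 1: "(\<Sum>i\<in>UNIV. \<Sum>j\<in>UNIV. \<Sum>k\<in>UNIV. g x $ j $ k * kron i l * u $ i * v $ j * w $ k)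
        = (\<Sum>j\<in>UNIV. \<Sum>k\<in>UNIV. g x $ j $ k * v $ j * w $ k) * (\<Sum>i\<in>UNIV. kron i l * u $ i)"
      unfolding sum_distrib_left sum_distrib_right
      by (intro sum.cong refl) (simp add: algebra_simps)
    have 2: "(\<Sum>i\<in>UNIV. \<Sum>j\<in>UNIV. \<Sum>k\<in>UNIV. g x $ i $ k * kron j l * u $ i * v $ j * w $ k)
        = (\<Sum>i\<in>UNIV. \<Sum>k\<in>UNIV. g x $ i $ k * u $ i * w $ k) * (\<Sum>j\<in>UNIV. kron j l * v $ j)"
      (is "?L = _")
    proof -
      have "?L = (\<Sum>j\<in>UNIV. \<Sum>i\<in>UNIV. \<Sum>k\<in>UNIV. g x $ i $ k * kron j l * u $ i * v $ j * w $ k)"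
        by (rule sum.swap)
      also have "\<dots> = (\<Sum>i\<in>UNIV. \<Sum>k\<in>UNIV. g x $ i $ k * u $ i * w $ k) * (\<Sum>j\<in>UNIV. kron j l * v $ j)"
        unfolding sum_distrib_left sum_distrib_right
        by (intro sum.cong refl) (simp add: algebra_simps)
      finally show ?thesis .
    qed
    have "riemann g x u v w $ l = (\<Sum>i\<in>UNIV. \<Sum>j\<in>UNIV. \<Sum>k\<in>UNIV.
        \<kappa> * (g x $ j $ k * kron i l * u $ i * v $ j * w $ k)
       - \<kappa> * (g x $ i $ k * kron j l * u $ i * v $ j * w $ k))"
      unfolding riemann_def vec_lambda_beta assms
      by (intro sum.cong refl) (simp add: algebra_simps)
    also have "\<dots> = \<kappa> * (\<Sum>i\<in>UNIV. \<Sum>j\<in>UNIV. \<Sum>k\<in>UNIV. g x $ j $ k * kron i l * u $ i * v $ j * w $ k)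
        - \<kappa> * (\<Sum>i\<in>UNIV. \<Sum>j\<in>UNIV. \<Sum>k\<in>UNIV. g x $ i $ k * kron j l * u $ i * v $ j * w $ k)"
      by (simp only: sum_subtractf sum_distrib_left)
    finally show ?thesis unfolding 1 2 by (simp add: algebra_simps)
  qed
  then show "riemann g x u v w $ l =
      (\<kappa> *\<^sub>R (metric_inner g x v w *\<^sub>R u - metric_inner g x u w *\<^sub>R v)) $ l"
    by (simp add: metric_inner_def)
qed

section \<open>The warping functions of space forms\<close>

text \<open>For \<open>k = 0\<close> this is \<open>sin (sqrt (\<kappa> t)) / sqrt (\<kappa> t)\<close>, continued to a power series in \<open>t\<close> that
  makes sense for every sign of \<open>\<kappa>\<close> and \<open>t\<close>; the index \<open>k\<close> counts derivatives. The warping function of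
  curvature \<open>\<kappa>\<close> is \<open>r * sinc \<kappa> 0 (r\<^sup>2)\<close>, so that its metric depends smoothly on \<open>t = \<bar>x\<bar>\<^sup>2\<close>, also at the
  pole.\<close>

definition sinc :: "real \<Rightarrow> nat \<Rightarrow> real \<Rightarrow> real" where
  "sinc \<kappa> k t = (\<Sum>n. (diffs ^^ k) (\<lambda>n. (-\<kappa>) ^ n / fact (2 * n + 1)) n * t ^ n)"

lemma sinc_summable:
  fixes t :: real
  shows "summable (\<lambda>n. (diffs ^^ k) (\<lambda>n. (-\<kappa>) ^ n / fact (2 * n + 1)) n * t ^ n)"
proof (induction k arbitrary: t)
  case 0
  show ?case
  proof (rule summable_comparison_test[OF _ summable_exp[of "\<bar>\<kappa> * t\<bar>"]], intro exI allI impI)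
    fix n :: nat
    have "(fact n :: real) \<le> fact (2 * n + 1)" by (rule fact_mono) simp
    then show "norm ((diffs ^^ 0) (\<lambda>n. (-\<kappa>) ^ n / fact (2 * n + 1)) n * t ^ n)
        \<le> inverse (fact n) * \<bar>\<kappa> * t\<bar> ^ n"
      by (simp add: abs_mult power_abs power_mult_distrib inverse_eq_divide frac_le del: fact_Suc)
  qed
next
  case (Suc k)
  then show ?case
    using termdiff_converges_all[OF Suc] by (simp only: funpow.simps comp_apply)
qed

lemma sinc_has_derivative [derivative_intros]:
  "(sinc \<kappa> k has_real_derivative sinc \<kappa> (Suc k) t) (at t)"
  using termdiffs_strong_converges_everywhere[OF sinc_summable[of k \<kappa>], of t]
  by (simp add: sinc_def[abs_def])

lemmas sinc_has_derivative' [derivative_intros] = DERIV_chain2[OF sinc_has_derivative]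

lemma sinc_at_0: "sinc \<kappa> 0 0 = 1"
  using powser_split_head(1)[OF sinc_summable[of 0 \<kappa> 0]] by (simp add: sinc_def)

text \<open>This is the equation \<open>s'' = - \<kappa> s\<close> for \<open>s r = r * sinc \<kappa> 0 (r\<^sup>2)\<close>, written in the variable \<open>t = r\<^sup>2\<close>.
  It is read off from the recursion of the coefficients.\<close>

lemma sinc_ode: "3 * sinc \<kappa> 1 t + 2 * t * sinc \<kappa> 2 t = - \<kappa> / 2 * sinc \<kappa> 0 t"
proof -
  define c :: "nat \<Rightarrow> real" where "c = (\<lambda>n. (-\<kappa>) ^ n / fact (2 * n + 1))"
  have sums: "(\<lambda>n. (diffs ^^ k) c n * t ^ n) sums sinc \<kappa> k t" for k
    unfolding sinc_def c_def by (rule summable_sums[OF sinc_summable])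
  have t2: "(\<lambda>n. real n * diffs c n * t ^ n) sums (t * sinc \<kappa> 2 t)"
  proof -
    have "(\<lambda>n. t * ((diffs ^^ 2) c n * t ^ n)) sums (t * sinc \<kappa> 2 t)"
      by (rule sums_mult[OF sums])
    then have "(\<lambda>n. real (Suc n) * diffs c (Suc n) * t ^ Suc n) sums (t * sinc \<kappa> 2 t)"
      by (simp add: eval_nat_numeral diffs_def[of "diffs c"] algebra_simps)
    then show ?thesis using sums_Suc_iff[of "\<lambda>n. real n * diffs c n * t ^ n"] by simp
  qed
  have "(\<lambda>n. 3 * (diffs c n * t ^ n) + 2 * (real n * diffs c n * t ^ n)) sums
      (3 * sinc \<kappa> 1 t + 2 * (t * sinc \<kappa> 2 t))"
    using sums[of 1] t2 by (intro sums_add sums_mult) simp_all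
  moreover have "3 * (diffs c n * t ^ n) + 2 * (real n * diffs c n * t ^ n)
      = - \<kappa> / 2 * (c n * t ^ n)" for n
  proof -
    have "c (Suc n) * (2 * real n + 3) * (2 * real n + 2) = - \<kappa> * c n"
    proof -
      have "fact (2 * Suc n + 1) = (2 * real n + 3) * ((2 * real n + 2) * fact (2 * n + 1))"
        by (simp add: algebra_simps)
      moreover have "2 * real n + 3 \<noteq> 0" "2 * real n + 2 \<noteq> 0" by linarith+
      ultimately show ?thesis by (simp add: c_def divide_simps del: fact_Suc)
    qed
    then have "(3 + 2 * real n) * diffs c n = - \<kappa> / 2 * c n"
      by (simp add: diffs_def algebra_simps)
    then have "(3 + 2 * real n) * diffs c n * t ^ n = - \<kappa> / 2 * c n * t ^ n" by simp
    then show ?thesis by (simp add: algebra_simps)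
  qed
  ultimately have "(\<lambda>n. - \<kappa> / 2 * (c n * t ^ n)) sums (3 * sinc \<kappa> 1 t + 2 * (t * sinc \<kappa> 2 t))"
    by simp
  moreover have "(\<lambda>n. - \<kappa> / 2 * (c n * t ^ n)) sums (- \<kappa> / 2 * sinc \<kappa> 0 t)"
    using sums[of 0] by (intro sums_mult) simp
  ultimately show ?thesis using sums_unique2 by (simp add: algebra_simps)
qed

text \<open>The conserved energy \<open>(s')\<^sup>2 + \<kappa> s\<^sup>2 = 1\<close> of \<open>s r = r * sinc \<kappa> 0 (r\<^sup>2)\<close>; the first square is \<open>s'\<close>.\<close>

lemma sinc_pythagoras: "(sinc \<kappa> 0 t + 2 * t * sinc \<kappa> 1 t)\<^sup>2 + \<kappa> * t * (sinc \<kappa> 0 t)\<^sup>2 = 1"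
proof -
  define F where "F t = (sinc \<kappa> 0 t + 2 * t * sinc \<kappa> 1 t)\<^sup>2 + \<kappa> * t * (sinc \<kappa> 0 t)\<^sup>2" for t
  have "(F has_real_derivative 0) (at t)" for t
  proof -
    have "(F has_real_derivative
       2 * (sinc \<kappa> 0 t + 2 * t * sinc \<kappa> 1 t) * (3 * sinc \<kappa> 1 t + 2 * t * sinc \<kappa> 2 t)
       + \<kappa> * (sinc \<kappa> 0 t)\<^sup>2 + 2 * \<kappa> * t * sinc \<kappa> 0 t * sinc \<kappa> 1 t) (at t)"
      unfolding F_def
      by (rule derivative_eq_intros refl)+ (simp add: algebra_simps numeral_2_eq_2)
    then show ?thesis
      unfolding sinc_ode by (simp add: algebra_simps power2_eq_square)
  qed
  then have "F t = F 0" using DERIV_isconst_all by blast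
  then show ?thesis by (simp add: F_def sinc_at_0)
qed

text \<open>Uniqueness for \<open>f'' = - \<kappa> f\<close>: with \<open>s\<close> the model solution and \<open>c\<close> its derivative, both
  \<open>f c - f' s\<close> and \<open>f' c + \<kappa> f s\<close> are constant, and \<open>c\<^sup>2 + \<kappa> s\<^sup>2 = 1\<close> lets one solve for \<open>f\<close>.
  Derivatives are taken within \<open>I\<close> so that end points are included.\<close>

lemma jacobi_ode_solution:
  assumes I: "convex I" "0 \<in> I" "r \<in> I"
    and f: "\<And>r. r \<in> I \<Longrightarrow> (f has_real_derivative f' r) (at r within I)"
    and f': "\<And>r. r \<in> I \<Longrightarrow> (f' has_real_derivative - \<kappa> * f r) (at r within I)"
    and init: "f 0 = 0" "f' 0 = 1"
  shows "f r = r * sinc \<kappa> 0 (r\<^sup>2)"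
proof -
  define s where "s r = r * sinc \<kappa> 0 (r\<^sup>2)" for r
  define c where "c r = sinc \<kappa> 0 (r\<^sup>2) + 2 * r\<^sup>2 * sinc \<kappa> 1 (r\<^sup>2)" for r
  have s: "(s has_real_derivative c r) (at r within I)" for r
    unfolding s_def c_def
    by (rule derivative_eq_intros refl)+ (simp add: algebra_simps power2_eq_square)
  have c: "(c has_real_derivative - \<kappa> * s r) (at r within I)" for r
  proof -
    have "(c has_real_derivative 2 * r * (3 * sinc \<kappa> 1 (r\<^sup>2) + 2 * r\<^sup>2 * sinc \<kappa> 2 (r\<^sup>2))) (at r within I)"
      unfolding c_def
      by (rule derivative_eq_intros refl)+ (simp add: algebra_simps power2_eq_square numeral_2_eq_2)
    then show ?thesis unfolding sinc_ode by (simp add: s_def mult_ac)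
  qed
  have d1: "((\<lambda>r. f r * c r - f' r * s r) has_real_derivative 0) (at r within I)" if "r \<in> I" for r
    by (rule derivative_eq_intros f[OF that] f'[OF that] s c refl)+ simp
  then obtain a where a: "\<And>r. r \<in> I \<Longrightarrow> f r * c r - f' r * s r = a"
    using has_field_derivative_zero_constant[OF I(1) d1] by blast
  have d2: "((\<lambda>r. f' r * c r + \<kappa> * f r * s r) has_real_derivative 0) (at r within I)" if "r \<in> I" for r
    by (rule derivative_eq_intros f[OF that] f'[OF that] s c refl)+ simp
  then obtain d where d: "\<And>r. r \<in> I \<Longrightarrow> f' r * c r + \<kappa> * f r * s r = d"
    using has_field_derivative_zero_constant[OF I(1) d2] by blast
  have "a = 0" "d = 1"
    using a[OF I(2)] d[OF I(2)] by (simp_all add: init s_def c_def sinc_at_0)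
  with a[OF I(3)] d[OF I(3)]
  have fc: "f r * c r = f' r * s r" and unit: "f' r * c r + \<kappa> * f r * s r = 1" by simp_all
  have pyth: "(c r)\<^sup>2 + \<kappa> * (s r)\<^sup>2 = 1"
    using sinc_pythagoras[of \<kappa> "r\<^sup>2"] by (simp add: c_def s_def power_mult_distrib mult_ac)
  have "f r = f r * ((c r)\<^sup>2 + \<kappa> * (s r)\<^sup>2)"
    by (simp add: pyth)
  also have "\<dots> = (f r * c r) * c r + \<kappa> * f r * s r * s r"
    by (simp add: power2_eq_square algebra_simps)
  also have "\<dots> = s r * (f' r * c r + \<kappa> * f r * s r)"
    unfolding fc by (simp add: algebra_simps)
  finally have "f r = s r" using unit by simp
  then show ?thesis by (simp add: s_def)
qed

text \<open>The algebra behind constant curvature. With \<open>S = sinc \<kappa> 0 t\<close> the coefficients of the metric are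
  \<open>\<phi> = S\<^sup>2\<close> and \<open>\<psi> = (1 - S\<^sup>2) / t\<close>; the formula for \<open>\<psi>\<close> used here is the one that survives at \<open>t = 0\<close>,
  obtained from \<open>unit\<close>. \<open>A\<close>, \<open>B\<close>, \<open>C\<close> are the coefficients of the Christoffel symbols and \<open>A'\<close>, \<open>B'\<close> are
  derivatives with respect to \<open>t\<close>. Since \<open>t\<close> may vanish, \<open>S''\<close> cannot be eliminated by solving \<open>ode\<close>;
  instead each identity, cleared of denominators, is exhibited as a combination of the two
  relations.\<close>

lemma space_form_identities:
  fixes S S' S'' t \<kappa> :: real
  assumes S0: "S \<noteq> 0"
    and ode: "3 * S' + 2 * t * S'' = - \<kappa> / 2 * S"
    and unit: "(S + 2 * t * S')\<^sup>2 + \<kappa> * t * S\<^sup>2 = 1"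
  defines "\<psi> \<equiv> \<kappa> * S\<^sup>2 + 4 * S * S' + 4 * t * S'\<^sup>2"
  defines "\<psi>' \<equiv> 2 * \<kappa> * S * S' + 8 * S'\<^sup>2 + 4 * S * S'' + 8 * t * S' * S''"
  defines "A \<equiv> 2 * S' / S" and "B \<equiv> \<psi> - 2 * S * S'" and "C \<equiv> \<psi>' - 4 * S' * \<psi> / S"
  defines "A' \<equiv> 2 * S'' / S - 2 * S'\<^sup>2 / S\<^sup>2" and "B' \<equiv> \<psi>' - 2 * S'\<^sup>2 - 2 * S * S''"
  shows "S\<^sup>2 + t * \<psi> = 1"
    and "B - A + t * A * B = \<kappa> * S\<^sup>2"
    and "A\<^sup>2 + C + t * A * C - 2 * A' = \<kappa> * \<psi>"
    and "B\<^sup>2 - C + t * B * C + 2 * B' = 0"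
proof -
  define c where "c = S + 2 * t * S'"
  \<comment> \<open>Both relations in the form \<open>P = 0\<close>, \<open>Q = 0\<close>; \<open>c\<close> is the derivative of \<open>r * sinc \<kappa> 0 (r\<^sup>2)\<close> and
    \<open>E\<close> is \<open>C\<close> cleared of its denominator.\<close>
  define P where "P = c\<^sup>2 + \<kappa> * t * S\<^sup>2 - 1"
  define Q where "Q = 6 * S' + 4 * t * S'' + \<kappa> * S"
  define E where "E = 4 * c * (S * S'' - 2 * S'\<^sup>2) - 2 * \<kappa> * S\<^sup>2 * S'"
  have P: "P = 0" and Q: "Q = 0"
    using unit ode by (simp_all add: P_def Q_def c_def)
  have A: "S * A = 2 * S'" and C: "S * C = E" and A': "S\<^sup>2 * A' = 2 * S * S'' - 2 * S'\<^sup>2"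
    using S0 by (simp_all add: A_def C_def A'_def E_def \<psi>_def \<psi>'_def c_def field_simps power2_eq_square)
  show "S\<^sup>2 + t * \<psi> = 1"
    using unit by (simp add: \<psi>_def algebra_simps power2_eq_square)
  have "S * (B - A + t * A * B - \<kappa> * S\<^sup>2) = S * B - S * A + t * B * (S * A) - \<kappa> * S ^ 3"
    by (simp add: algebra_simps power2_eq_square power3_eq_cube)
  also have "\<dots> = 2 * S' * P"
    unfolding A by (simp add: B_def \<psi>_def P_def c_def algebra_simps power2_eq_square power3_eq_cube)
  finally show "B - A + t * A * B = \<kappa> * S\<^sup>2"
    using S0 P by simp
  have "S\<^sup>2 * (A\<^sup>2 + C + t * A * C - 2 * A' - \<kappa> * \<psi>) =
      (S * A)\<^sup>2 + S * (S * C) + t * (S * A) * (S * C) - 2 * (S\<^sup>2 * A') - \<kappa> * \<psi> * S\<^sup>2"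
    by (simp add: algebra_simps power2_eq_square)
  also have "\<dots> = (4 * S * S'' - 8 * S'\<^sup>2) * P - \<kappa> * S ^ 3 * Q"
    unfolding A C A'
    by (simp add: E_def \<psi>_def P_def Q_def c_def algebra_simps power2_eq_square power3_eq_cube)
  finally show "A\<^sup>2 + C + t * A * C - 2 * A' = \<kappa> * \<psi>"
    using S0 P Q by simp
  have "S * (B\<^sup>2 - C + t * B * C + 2 * B') = S * B\<^sup>2 - S * C + t * B * (S * C) + 2 * S * B'"
    by (simp add: algebra_simps)
  also have "\<dots> = (S * (12 * S'\<^sup>2 - 4 * S * S'') + E) * P + S * (4 * S' + \<kappa> * S ^ 3) * Q"
    unfolding C
    by (simp add: E_def B_def B'_def \<psi>_def \<psi>'_def P_def Q_def c_def
        algebra_simps power2_eq_square power3_eq_cube)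
  finally show "B\<^sup>2 - C + t * B * C + 2 * B' = 0"
    using S0 P Q by simp
qed

section \<open>Curvature of a space form patch\<close>

text \<open>The derivative of \<open>sgn\<close> at \<open>x\<close> is the projection orthogonal to \<open>x\<close>, scaled by \<open>1 / \<bar>x\<bar>\<close>, and that of
  the norm is the projection to \<open>x\<close>; so the sphere part only sees the component orthogonal to \<open>x\<close>.\<close>

lemma model_form_polar:
  fixes x :: "real^'n::finite"
  assumes "x \<noteq> 0"
  shows "model_form f x u v =
           (f (norm x))\<^sup>2 / (x \<bullet> x) * (u \<bullet> v - (x \<bullet> u) * (x \<bullet> v) / (x \<bullet> x))
           + (x \<bullet> u) * (x \<bullet> v) / (x \<bullet> x)"
proof -
  define n where "n = norm x"
  have n0: "n \<noteq> 0" and xx: "x \<bullet> x = n\<^sup>2"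
    using assms by (simp_all add: n_def power2_norm_eq_inner)
  have N: "(norm has_derivative (\<lambda>u. u \<bullet> sgn x)) (at x)"
    by (rule has_derivative_norm[OF assms])
  have dnorm: "frechet_derivative norm (at x) w = (x \<bullet> w) / n" for w
    using frechet_derivative_at[OF N]
    by (metis (no_types, lifting) divide_inverse inner_commute inner_scaleR_left mult.commute n_def sgn_div_norm)
  have "((\<lambda>y. inverse (norm y)) has_derivative (\<lambda>w. - (inverse n * (w \<bullet> sgn x) * inverse n))) (at x)"
    using Deriv.has_derivative_inverse[OF _ N] assms by (simp add: n_def)
  from has_derivative_scaleR[OF this has_derivative_ident]
  have "((\<lambda>y. inverse (norm y) *\<^sub>R y) has_derivative
      (\<lambda>w. inverse n *\<^sub>R w - ((w \<bullet> sgn x) / n\<^sup>2) *\<^sub>R x)) (at x)"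
    by (simp add: n_def divide_inverse power2_eq_square mult_ac)
  then have dS: "(sgn has_derivative (\<lambda>w. inverse n *\<^sub>R w - ((w \<bullet> sgn x) / n\<^sup>2) *\<^sub>R x)) (at x)"
    by (simp add: sgn_div_norm[abs_def])
  have dsgn: "frechet_derivative sgn (at x) w = inverse n *\<^sub>R w - ((x \<bullet> w) / n ^ 3) *\<^sub>R x" for w
    by (simp add: frechet_derivative_at[OF dS, symmetric] sgn_div_norm n_def[symmetric]
        inner_commute[of w x] divide_inverse power2_eq_square power3_eq_cube mult_ac)
  have "frechet_derivative sgn (at x) u \<bullet> frechet_derivative sgn (at x) v
      = (u \<bullet> v - (x \<bullet> u) * (x \<bullet> v) / n\<^sup>2) / n\<^sup>2"
    unfolding dsgn inner_diff_left inner_diff_right inner_scaleR_left inner_scaleR_right xx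
      inner_commute[of u x]
    using n0 by (simp add: field_simps eval_nat_numeral)
  then show ?thesis
    using assms by (simp add: model_form_def dnorm xx n_def[symmetric] power2_eq_square)
qed

text \<open>Multiplied by \<open>x \<bullet> x\<close> the form is a sum of a Cauchy-Schwarz defect and \<open>(x \<bullet> w)\<^sup>2\<close>; if both
  vanish, only \<open>p * (w \<bullet> w)\<close> is left. This argument covers \<open>x = 0\<close> without a case distinction.\<close>

lemma quadratic_form_pos:
  fixes x w :: "'a::real_inner"
  assumes "0 < p" "p + (x \<bullet> x) * q = 1" "w \<noteq> 0"
  shows "0 < p * (w \<bullet> w) + q * (x \<bullet> w)\<^sup>2"
proof (rule ccontr)
  assume neg: "\<not> ?thesis"
  have "(x \<bullet> x) * (p * (w \<bullet> w) + q * (x \<bullet> w)\<^sup>2)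
      = p * ((x \<bullet> x) * (w \<bullet> w) - (x \<bullet> w)\<^sup>2) + (p + (x \<bullet> x) * q) * (x \<bullet> w)\<^sup>2"
    by (simp add: algebra_simps)
  then have "(x \<bullet> x) * (p * (w \<bullet> w) + q * (x \<bullet> w)\<^sup>2)
      = p * ((x \<bullet> x) * (w \<bullet> w) - (x \<bullet> w)\<^sup>2) + (x \<bullet> w)\<^sup>2"
    by (simp only: assms(2) mult_1)
  moreover have "(x \<bullet> x) * (p * (w \<bullet> w) + q * (x \<bullet> w)\<^sup>2) \<le> 0"
    using neg by (intro mult_nonneg_nonpos) auto
  moreover have "0 \<le> p * ((x \<bullet> x) * (w \<bullet> w) - (x \<bullet> w)\<^sup>2)"
    using assms(1) Cauchy_Schwarz_ineq[of x w] by simp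
  ultimately have "(x \<bullet> w)\<^sup>2 \<le> 0" by linarith
  then have "x \<bullet> w = 0" by simp
  with neg assms show False by simp
qed

text \<open>Since \<open>f\<^sup>2(r) = r\<^sup>2 S\<^sup>2(r\<^sup>2)\<close> with \<open>S\<close> a power series, the metric is a rotationally symmetric one whose
  coefficients are smooth in \<open>\<bar>x\<bar>\<^sup>2\<close>, and the pole needs no limit argument. The hypothesis \<open>regular\<close>
  keeps the metric nondegenerate; it excludes exactly the zeros of \<open>f\<close> away from the pole.\<close>

lemma sectional_curvature_space_form_patch:
  fixes U :: "(real^'n::finite) set"
  assumes U: "open U" "x \<in> U"
    and profile: "\<And>y. y \<in> U \<Longrightarrow> f (norm y) = norm y * sinc \<kappa> 0 (y \<bullet> y)"
    and regular: "\<And>y. y \<in> U \<Longrightarrow> sinc \<kappa> 0 (y \<bullet> y) \<noteq> 0"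
    and plane: "u \<noteq> v" "independent {u, v}"
  shows "sectional_curvature (model_metric f) x u v = \<kappa>"
proof -
  let ?g = "model_metric f :: 'n metric"
  let ?S = "sinc \<kappa>"
  define \<phi> where "\<phi> t = (?S 0 t)\<^sup>2" for t
  define \<psi> where "\<psi> t = \<kappa> * (?S 0 t)\<^sup>2 + 4 * ?S 0 t * ?S 1 t + 4 * t * (?S 1 t)\<^sup>2" for t
  define \<psi>' where "\<psi>' t = 2 * \<kappa> * ?S 0 t * ?S 1 t + 8 * (?S 1 t)\<^sup>2 + 4 * ?S 0 t * ?S 2 t
      + 8 * t * ?S 1 t * ?S 2 t" for t
  define A where "A t = 2 * ?S 1 t / ?S 0 t" for t
  define B where "B t = \<psi> t - 2 * ?S 0 t * ?S 1 t" for t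
  define C where "C t = \<psi>' t - 4 * ?S 1 t * \<psi> t / ?S 0 t" for t
  have ids: "\<phi> t + t * \<psi> t = 1"
    "B t - A t + t * A t * B t = \<kappa> * \<phi> t"
    "(A t)\<^sup>2 + C t + t * A t * C t - 2 * (2 * ?S 2 t / ?S 0 t - 2 * (?S 1 t)\<^sup>2 / (?S 0 t)\<^sup>2)
      = \<kappa> * \<psi> t"
    "(B t)\<^sup>2 - C t + t * B t * C t + 2 * (\<psi>' t - 2 * (?S 1 t)\<^sup>2 - 2 * ?S 0 t * ?S 2 t) = 0"
    if "?S 0 t \<noteq> 0" for t
    unfolding A_def B_def C_def \<phi>_def \<psi>_def \<psi>'_def
    by (rule space_form_identities[OF that sinc_ode sinc_pythagoras])+
  have \<phi>: "(\<phi> has_real_derivative 2 * ?S 0 t * ?S 1 t) (at t)" for t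
    unfolding \<phi>_def by (rule derivative_eq_intros refl)+ simp
  have \<psi>: "(\<psi> has_real_derivative \<psi>' t) (at t)" for t
    unfolding \<psi>_def \<psi>'_def
    by (rule derivative_eq_intros refl)+ (simp add: algebra_simps power2_eq_square numeral_2_eq_2)
  have A: "(A has_real_derivative 2 * ?S 2 t / ?S 0 t - 2 * (?S 1 t)\<^sup>2 / (?S 0 t)\<^sup>2) (at t)"
    if "?S 0 t \<noteq> 0" for t
    unfolding A_def
    by (rule derivative_eq_intros refl that)+
      (use that in \<open>simp add: field_simps power2_eq_square numeral_2_eq_2\<close>)
  have B: "(B has_real_derivative \<psi>' t - 2 * (?S 1 t)\<^sup>2 - 2 * ?S 0 t * ?S 2 t) (at t)" for t
    unfolding B_def
    by (rule derivative_eq_intros refl \<psi>)+ (simp add: algebra_simps power2_eq_square numeral_2_eq_2)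
  \<comment> \<open>The derivative of \<open>C\<close> cancels in the curvature, so that its existence is enough.\<close>
  have "\<exists>C'. (C has_real_derivative C') (at t)" if "?S 0 t \<noteq> 0" for t
    unfolding C_def \<psi>'_def
    by (rule exI) (rule derivative_eq_intros refl \<psi> that)+
  then obtain C' where C: "\<And>t. ?S 0 t \<noteq> 0 \<Longrightarrow> (C has_real_derivative C' t) (at t)"
    by metis
  have g: "?g y $ i $ j = \<phi> (y \<bullet> y) * kron i j + \<psi> (y \<bullet> y) * (y $ i * y $ j)"
    if "y \<in> U" for y i j
  proof (cases "y = 0")
    case True
    then show ?thesis
      by (simp add: model_metric_def model_form_def \<phi>_def sinc_at_0 kron_def inner_axis_axis)
  next
    case False
    have "\<phi> (y \<bullet> y) + (y \<bullet> y) * \<psi> (y \<bullet> y) = 1"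
      by (rule ids(1)[OF regular[OF that]])
    moreover have "(f (norm y))\<^sup>2 = (y \<bullet> y) * \<phi> (y \<bullet> y)"
      by (simp add: profile[OF that] \<phi>_def power_mult_distrib power2_norm_eq_inner)
    moreover have "axis i 1 \<bullet> (axis j 1 :: real^'n) = kron i j"
      by (simp add: inner_axis_axis kron_def)
    ultimately show ?thesis
      using False
      by (simp add: model_metric_def model_form_polar inner_axis field_simps)
        (metis distrib_left mult.right_neutral mult.commute)
  qed
  have \<Gamma>: "christoffel ?g k i j y =
      A (y \<bullet> y) * (y $ i * kron j k + y $ j * kron i k) + B (y \<bullet> y) * (kron i j * y $ k)
      + C (y \<bullet> y) * (y $ i * y $ j * y $ k)" if "y \<in> U" for y i j k
    using christoffel_radial[OF U(1) that g \<phi> _ \<psi> ids(1)[OF regular[OF that]], of k i j] regular[OF that]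
    by (simp add: A_def B_def C_def \<phi>_def power2_eq_square mult_ac)
  define t where "t = x \<bullet> x"
  have S0: "?S 0 t \<noteq> 0" using regular[OF U(2)] by (simp add: t_def)
  have R: "riemann_coeff ?g l i j k x = \<kappa> * (?g x $ j $ k * kron i l - ?g x $ i $ k * kron j l)"
    for l i j k
    using riemann_coeff_radial[where A = A and B = B and C = C and l = l and i = i and j = j and k = k,
        OF U \<Gamma> A[OF regular[OF U(2)]] B C[OF regular[OF U(2)]]]
    unfolding t_def[symmetric] ids(2-4)[OF S0] g[OF U(2), folded t_def]
    by (simp add: algebra_simps)
  let ?q = "metric_inner ?g x"
  have q: "?q a c = \<phi> t * (a \<bullet> c) + \<psi> t * (x \<bullet> a) * (x \<bullet> c)" for a c
  proof -
    have "?q a c = \<phi> t * (\<Sum>i\<in>UNIV. (\<Sum>j\<in>UNIV. kron i j * c $ j) * a $ i)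
        + \<psi> t * (\<Sum>i\<in>UNIV. (\<Sum>j\<in>UNIV. x $ j * c $ j) * (x $ i * a $ i))"
      unfolding metric_inner_def g[OF U(2), folded t_def] sum_distrib_left sum_distrib_right
        sum.distrib[symmetric]
      by (intro sum.cong refl) (simp add: algebra_simps)
    then show ?thesis
      unfolding sum_kron_left sum_distrib_left[symmetric] by (simp add: inner_vec_def mult_ac)
  qed
  have pos: "0 < ?q w w" if "w \<noteq> 0" for w
  proof -
    have "0 < \<phi> t" using S0 by (simp add: \<phi>_def)
    moreover have "\<phi> t + (x \<bullet> x) * \<psi> t = 1" using ids(1)[OF S0] by (simp add: t_def)
    ultimately have "0 < \<phi> t * (w \<bullet> w) + \<psi> t * (x \<bullet> w)\<^sup>2"
      using that by (rule quadratic_form_pos)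
    then show ?thesis by (simp add: q power2_eq_square mult.assoc)
  qed
  \<comment> \<open>\<open>w\<close> is a multiple of the component of \<open>u\<close> orthogonal to \<open>v\<close>; its positive length gives the
    positive Gram determinant, and \<open>R(u, v) v = \<kappa> w\<close>.\<close>
  define w where "w = ?q v v *\<^sub>R u - ?q u v *\<^sub>R v"
  have uv: "v \<noteq> 0" "u \<notin> span {v}"
    using plane by (auto simp: independent_insert split: if_splits)
  have "w \<noteq> 0"
  proof
    assume "w = 0"
    then have "?q v v *\<^sub>R u \<in> span {v}" by (simp add: w_def span_base span_scale)
    then have "u \<in> span {v}" using span_scale[of _ "{v}" "inverse (?q v v)"] pos[OF uv(1)] by fastforce
    with uv(2) show False ..
  qed
  have "?q w w = ?q v v * (?q u u * ?q v v - (?q u v)\<^sup>2)"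
    unfolding w_def q
    by (simp add: inner_diff_left inner_diff_right inner_commute[of v u] power2_eq_square algebra_simps)
  with pos[OF \<open>w \<noteq> 0\<close>] have gram: "?q u u * ?q v v - (?q u v)\<^sup>2 \<noteq> 0" by auto
  have "riemann ?g x u v v = \<kappa> *\<^sub>R w"
    unfolding w_def by (rule riemann_of_space_form[OF R])
  moreover have "?q (\<kappa> *\<^sub>R w) u = \<kappa> * (?q u u * ?q v v - (?q u v)\<^sup>2)"
    unfolding w_def q
    by (simp add: inner_diff_left inner_diff_right inner_commute[of v u] power2_eq_square algebra_simps)
  ultimately show ?thesis
    unfolding sectional_curvature_def using gram by simp
qed

section \<open>From the third-order equation to constant curvature\<close>

lemma nth_deriv_on_has_derivative:
  assumes "smooth_on_real S f" "r \<in> S"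
  shows "(nth_deriv_on S k f has_real_derivative nth_deriv_on S (Suc k) f r) (at r within S)"
proof -
  have "nth_deriv_on S k f differentiable at r within S"
    using assms by (auto simp: smooth_on_real_def differentiable_on_def)
  then show ?thesis
    by (simp add: vector_derivative_works nth_deriv_on_def has_real_derivative_iff_has_vector_derivative)
qed

text \<open>The left-hand side of the equation, divided by \<open>- h\<^sup>3\<close>, is the derivative of \<open>K\<^sub>r + K\<^sub>t\<close>, where
  \<open>K\<^sub>r = - h'' / h\<close> and \<open>K\<^sub>t = (1 - h'\<^sup>2) / h\<^sup>2\<close> are the radial and the tangential curvature, while every
  warping function satisfies \<open>K\<^sub>t' = 2 (h' / h) (K\<^sub>r - K\<^sub>t)\<close>. Hence \<open>h\<^sup>4 (K\<^sub>r - K\<^sub>t)\<close> is constant, and it vanishes at the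
  pole. So \<open>K\<^sub>r = K\<^sub>t\<close>, and their common value is constant because their sum is. The set \<open>J\<close> is where one
  may divide by \<open>h\<close>.\<close>

lemma warping_ode_linear:
  assumes I: "convex I" "0 \<in> I"
    and J: "convex J" "J \<subseteq> I" "\<And>r. r \<in> J \<Longrightarrow> h r \<noteq> 0"
    and h: "\<And>r. r \<in> I \<Longrightarrow> (h has_real_derivative h1 r) (at r within I)"
    and h1: "\<And>r. r \<in> I \<Longrightarrow> (h1 has_real_derivative h2 r) (at r within I)"
    and h2: "\<And>r. r \<in> I \<Longrightarrow> (h2 has_real_derivative h3 r) (at r within I)"
    and "h 0 = 0"
    and ode: "\<And>r. r \<in> I \<Longrightarrow> (h r)\<^sup>2 * h3 r + h1 r * (2 + h r * h2 r) - 2 * (h1 r) ^ 3 = 0"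
  obtains \<kappa> where "\<And>r. r \<in> J \<Longrightarrow> h2 r = - \<kappa> * h r"
proof -
  \<comment> \<open>This function is \<open>- h\<^sup>4 (K\<^sub>r - K\<^sub>t)\<close>, written without division.\<close>
  have dE: "((\<lambda>r. (h r)\<^sup>2 * (h r * h2 r + 1 - (h1 r)\<^sup>2)) has_real_derivative 0) (at r within I)"
    if "r \<in> I" for r
  proof -
    have "((\<lambda>r. (h r)\<^sup>2 * (h r * h2 r + 1 - (h1 r)\<^sup>2)) has_real_derivative
       h r * ((h r)\<^sup>2 * h3 r + h1 r * (2 + h r * h2 r) - 2 * (h1 r) ^ 3)) (at r within I)"
      by (rule derivative_eq_intros h h1 h2 that refl)+
        (simp add: algebra_simps power2_eq_square power3_eq_cube)
    then show ?thesis by (simp add: ode[OF that])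
  qed
  obtain a where "\<And>r. r \<in> I \<Longrightarrow> (h r)\<^sup>2 * (h r * h2 r + 1 - (h1 r)\<^sup>2) = a"
    using has_field_derivative_zero_constant[OF I(1) dE] by blast
  then have "(h r)\<^sup>2 * (h r * h2 r + 1 - (h1 r)\<^sup>2) = 0" if "r \<in> I" for r
    using that I(2) \<open>h 0 = 0\<close> by fastforce
  then have umbilic: "h r * h2 r = (h1 r)\<^sup>2 - 1" if "r \<in> J" for r
    using J(2) J(3)[OF that] that by fastforce
  have dK: "((\<lambda>r. h2 r / h r) has_real_derivative 0) (at r within J)" if "r \<in> J" for r
  proof -
    have rI: "r \<in> I" using that J(2) by auto
    have "h r * (h r * h3 r - h1 r * h2 r) =
        ((h r)\<^sup>2 * h3 r + h1 r * (2 + h r * h2 r) - 2 * (h1 r) ^ 3)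
        - 2 * h1 r * (h r * h2 r - ((h1 r)\<^sup>2 - 1))"
      by (simp add: algebra_simps power2_eq_square power3_eq_cube)
    then have "h r * h3 r = h1 r * h2 r"
      using ode[OF rI] umbilic[OF that] J(3)[OF that] by simp
    then show ?thesis
      using J(3)[OF that]
      by (auto intro!: derivative_eq_intros DERIV_subset[OF h[OF rI] J(2)] DERIV_subset[OF h2[OF rI] J(2)]
          simp: mult_ac)
  qed
  obtain c where "\<And>r. r \<in> J \<Longrightarrow> h2 r / h r = c"
    using has_field_derivative_zero_constant[OF J(1) dK] by blast
  then have "h2 r = - (- c) * h r" if "r \<in> J" for r
    using J(3)[OF that] that by (metis minus_minus nonzero_divide_eq_eq)
  then show ?thesis by (rule that)
qed

theorem theorem3p9:
  fixes h :: "real \<Rightarrow> real" and b :: ereal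
  defines "D \<equiv> \<lambda>k. nth_deriv_on (warping_domain b) k h"
  assumes "warping_function b h"
    and "\<And>r. r \<in> warping_domain b \<Longrightarrow>
           (h r)^2 * D 3 r + D 1 r * (2 + h r * D 2 r) - 2 * (D 1 r)^3 = 0"
  shows "constant_sectional_curvature (model_atlas b h :: ((real^4) set \<times> 4 metric) set)"
proof -
  let ?I = "warping_domain b"
  define J where "J = {r. 0 < r \<and> ereal r < b}"
  have b0: "0 < b" and smooth: "smooth_on_real ?I h" and h0: "h 0 = 0" and D10: "D 1 0 = 1"
    and hpos: "\<And>r. r \<in> J \<Longrightarrow> 0 < h r" and D20: "D 2 0 = 0"
    and antipode: "\<And>\<beta>. b = ereal \<beta> \<Longrightarrow> h \<beta> = 0 \<and> D 1 \<beta> = -1 \<and> D 2 \<beta> = 0"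
    using assms(2) unfolding warping_function_def D_def J_def
    by (auto dest!: spec[of _ 1])
  have I0: "0 \<in> ?I" using b0 by (simp add: warping_domain_def zero_ereal_def)
  have conv: "convex ?I" "convex J"
    unfolding warping_domain_def J_def is_interval_convex_1[symmetric] is_interval_1
    by (auto intro: order_trans[OF ereal_less_eq(3)[THEN iffD2]] le_less_trans[OF ereal_less_eq(3)[THEN iffD2]])
  have JI: "J \<subseteq> ?I" by (auto simp: J_def warping_domain_def)
  have deriv: "(D k has_real_derivative D (Suc k) r) (at r within ?I)" if "r \<in> ?I" for k r
    unfolding D_def by (rule nth_deriv_on_has_derivative[OF smooth that])
  have D0: "D 0 = h" by (simp add: D_def nth_deriv_on_def)
  obtain \<kappa> where \<kappa>: "\<And>r. r \<in> J \<Longrightarrow> D 2 r = - \<kappa> * h r"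
  proof (rule warping_ode_linear[OF conv(1) I0 conv(2) JI])
    show "h r \<noteq> 0" if "r \<in> J" for r using hpos[OF that] by simp
    show "(h has_real_derivative D 1 r) (at r within ?I)" if "r \<in> ?I" for r
      using deriv[OF that, of 0] by (simp add: D0)
    show "(D 1 has_real_derivative D 2 r) (at r within ?I)"
      "(D 2 has_real_derivative D 3 r) (at r within ?I)" if "r \<in> ?I" for r
      using deriv[OF that, of 1] deriv[OF that, of 2] by (simp_all add: eval_nat_numeral)
  qed (use h0 assms(3) in auto)
  \<comment> \<open>At the ends of the domain both sides vanish: \<open>h\<close> and its even derivatives are zero there.\<close>
  have jacobi: "D 2 r = - \<kappa> * h r" if "r \<in> ?I" for r
  proof -
    consider "r \<in> J" | "r = 0" | "b = ereal r"
      using \<open>r \<in> ?I\<close> by (force simp: J_def warping_domain_def)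
    then show ?thesis
      by cases (use \<kappa> h0 D20 antipode in auto)
  qed
  have dh: "(h has_real_derivative D 1 r) (at r within ?I)"
    and dh': "(D 1 has_real_derivative - \<kappa> * h r) (at r within ?I)" if "r \<in> ?I" for r
    using deriv[OF that, of 0] deriv[OF that, of 1] jacobi[OF that] by (simp_all add: D0 eval_nat_numeral)
  have patch: "sectional_curvature (model_metric f) x u v = \<kappa>"
    if f: "\<And>r. r \<in> ?I \<Longrightarrow> f r = r * sinc \<kappa> 0 (r\<^sup>2)" "\<And>r. r \<in> J \<Longrightarrow> 0 < f r"
      and x: "ereal (norm x) < b" and uv: "u \<noteq> v" "independent {u, v}"
    for f and x u v :: "real^4"
  proof (rule sectional_curvature_space_form_patch[OF _ _ _ _ uv])
    show "open {y::real^4. ereal (norm y) < b}"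
      by (intro open_Collect_less continuous_intros)
    fix y :: "real^4" assume "y \<in> {y. ereal (norm y) < b}"
    then have y: "norm y \<in> ?I" "y \<noteq> 0 \<Longrightarrow> norm y \<in> J" by (auto simp: J_def warping_domain_def)
    show fy: "f (norm y) = norm y * sinc \<kappa> 0 (y \<bullet> y)"
      using f(1)[OF y(1)] by (simp add: power2_norm_eq_inner)
    show "sinc \<kappa> 0 (y \<bullet> y) \<noteq> 0"
      using f(2)[OF y(2)] fy by (cases "y = 0") (auto simp: sinc_at_0)
  qed (use x in simp)
  have pole: "h r = r * sinc \<kappa> 0 (r\<^sup>2)" if "r \<in> ?I" for r
    using jacobi_ode_solution[OF conv(1) I0 that dh dh' h0 D10] .
  \<comment> \<open>Seen from the antipodal point the warping function solves the same linear equation, and with the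
    same initial values, because \<open>h' = -1\<close> there. So the same \<open>\<kappa>\<close> serves both patches.\<close>
  have opposite: "h (\<beta> - r) = r * sinc \<kappa> 0 (r\<^sup>2)" if b: "b = ereal \<beta>" and r: "r \<in> ?I" for \<beta> r
  proof (rule jacobi_ode_solution[OF conv(1) I0 r])
    have I: "?I = {0..\<beta>}" using b by (auto simp: warping_domain_def)
    have image: "(\<lambda>s. \<beta> - s) ` ?I \<subseteq> ?I" by (auto simp: I)
    fix s assume s: "s \<in> ?I"
    then have s': "\<beta> - s \<in> ?I" by (auto simp: I)
    have refl: "((\<lambda>s. \<beta> - s) has_real_derivative -1) (at s within ?I)"
      by (auto intro!: derivative_eq_intros)
    show "((\<lambda>s. h (\<beta> - s)) has_real_derivative - D 1 (\<beta> - s)) (at s within ?I)"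
      using DERIV_image_chain[OF DERIV_subset[OF dh[OF s'] image] refl] by (simp add: o_def)
    show "((\<lambda>s. - D 1 (\<beta> - s)) has_real_derivative - \<kappa> * h (\<beta> - s)) (at s within ?I)"
      using DERIV_minus[OF DERIV_image_chain[OF DERIV_subset[OF dh'[OF s'] image] refl]]
      by (simp add: o_def)
  qed (use antipode[OF b] in simp_all)
  have const: "sectional_curvature g x u v = \<kappa>"
    if patch_in: "(U, g) \<in> model_atlas b h" and x: "x \<in> U" and uv: "u \<noteq> v" "independent {u, v}"
    for U g and x u v :: "real^4"
    using patch_in unfolding model_atlas_def
  proof
    assume "(U, g) \<in> {({x. ereal (norm x) < b}, model_metric h)}"
    with x show ?thesis using patch[OF pole hpos _ uv] by auto
  next
    assume "(U, g) \<in> {({x. norm x < \<beta>}, model_metric (\<lambda>s. h (\<beta> - s))) |\<beta>. b = ereal \<beta>}"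
    then obtain \<beta> where \<beta>: "b = ereal \<beta>" and Ug: "U = {x. norm x < \<beta>}" "g = model_metric (\<lambda>s. h (\<beta> - s))"
      by auto
    have "0 < h (\<beta> - r)" if "r \<in> J" for r
      using that hpos[of "\<beta> - r"] by (auto simp: J_def \<beta>)
    then show ?thesis
      using patch[OF opposite[OF \<beta>] _ _ uv] x by (simp add: Ug \<beta>)
  qed
  show ?thesis
    unfolding constant_sectional_curvature_def
  proof (rule exI[of _ \<kappa>], clarify)
    fix U and g :: "4 metric" and x u v :: "real^4"
    assume "(U, g) \<in> model_atlas b h" "x \<in> U" "u \<noteq> v" "independent {u, v}"
    then show "sectional_curvature g x u v = \<kappa>" by (rule const)
  qed
qed

end
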